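(* Let $G$ be a free abelian group and let $T\subseteq G$ be a generating subset of $G$ such that $0\in T$ and $2g-t\in T$ for all $g\in G$ and $t\in T$. Let $\mathcal{U}$ be the group with presentation $$\mathcal{U}=\big\langle (t^{\mathcal U})_{t\in T}\;\big|\;(t^{\mathcal U})^2=1,\ t^{\mathcal U}s^{\mathcal U}(t^{\mathcal U})^{-1}=(2t-s)^{\mathcal U}\text{ for all } s,t\in T\big\rangle,$$ and let $\mathcal{W}$ (the Weyl group) be the subgroup generated by $\{(0,t,-1)\mid t\in T\}$ of the group $(G\wedge G)\times G\times\{1,-1\}$ with multiplication $(l,g,v)(l',g',v')=(l+l'+g\wedge(vg'),\,g+vg',\,vv')$. Let $\mathcal U\to\mathcal W$ be the group homomorphism determined by $t^{\mathcal U}\mapsto(0,t,-1)$ for $t\in T$. Let $G_2=G/2G$ and let $T^{\mathrm{ab}}$ be the image of $T$ under the quotient map $G\to G_2$. Then $\mathcal U\to\mathcal W$ is an isomorphism if and only if $T^{\mathrm{ab}}\setminus\{0\}$ is $2$-independent in $G_2$.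
   Context: $G\wedge G$ is the exterior square of $G$. $G_2=G/2G$ is regarded as a vector space over $\mathbb{F}_2$. A subset $M$ of $G_2$ is called 2-dependent if the elements of the set $\{g\otimes g\mid g\in M\}$ are linearly dependent over $\mathbb{F}_2$ in $G_2\otimes G_2$, and 2-independent if it is not 2-dependent. The homomorphism $\mathcal U\to\mathcal W$ exists because the elements $(0,t,-1)$ satisfy the defining relations of $\mathcal U$. *)

theory Defs
  imports "HOL-Algebra.Algebra" "HOL-Library.Poly_Mapping" "HOL-Library.Z2"
begin

type_synonym 'b fag = "'b \<Rightarrow>\<^sub>0 int"

definition fag_group :: "('b fag) monoid" where
  "fag_group = \<lparr>carrier = UNIV, monoid.mult = (+), monoid.one = 0\<rparr>"

definition zscale :: "int \<Rightarrow> 'b fag \<Rightarrow> 'b fag" where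
  "zscale v g = Poly_Mapping.map (\<lambda>n. v * n) g"

section \<open>Exterior square G wedge G (model: alternating integer matrices on the basis)\<close>

type_synonym 'b ext = "('b \<times> 'b) \<Rightarrow>\<^sub>0 int"

definition wedge :: "'b fag \<Rightarrow> 'b fag \<Rightarrow> 'b ext" where
  "wedge g h = Abs_poly_mapping
     (\<lambda>(i, j). Poly_Mapping.lookup g i * Poly_Mapping.lookup h j - Poly_Mapping.lookup g j * Poly_Mapping.lookup h i)"

definition ext_group :: "('b ext) monoid" where
  "ext_group = \<lparr>carrier = UNIV, monoid.mult = (+), monoid.one = 0\<rparr>"

definition ext_square :: "'b ext set" where
  "ext_square = generate ext_group {wedge g h | g h. True}"

definition amb_group :: "('b ext \<times> 'b fag \<times> int) monoid" where
  "amb_group = \<lparr>carrier = {(l, g, v). l \<in> ext_square \<and> v \<in> {1, -1}},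
     monoid.mult = (\<lambda>(l, g, v) (l', g', v').
               (l + l' + wedge g (zscale v g'), g + zscale v g', v * v')),
     monoid.one = (0, 0, 1)\<rparr>"

definition weyl_gen :: "'b fag \<Rightarrow> 'b ext \<times> 'b fag \<times> int" where
  "weyl_gen t = (0, t, -1)"

definition weyl_group :: "'b fag set \<Rightarrow> ('b ext \<times> 'b fag \<times> int) monoid" where
  "weyl_group T = amb_group\<lparr>carrier := generate amb_group (weyl_gen ` T)\<rparr>"

text \<open>Words in the free group on T: letters (t, True) = t and (t, False) = t inverse.\<close>

type_synonym 'b word = "('b fag \<times> bool) list"

definition T_word :: "'b fag set \<Rightarrow> 'b word \<Rightarrow> bool" where
  "T_word T w \<longleftrightarrow> (\<forall>x \<in> set w. fst x \<in> T)"

inductive pres_rel :: "'b fag set \<Rightarrow> 'b word \<Rightarrow> 'b word \<Rightarrow> bool" for T where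
  free_cancel: "t \<in> T \<Longrightarrow> pres_rel T [(t, b), (t, \<not> b)] []"
| rel_square: "t \<in> T \<Longrightarrow> pres_rel T [(t, True), (t, True)] []"
| rel_conj: "s \<in> T \<Longrightarrow> t \<in> T \<Longrightarrow>
     pres_rel T [(t, True), (s, True), (t, False), (t + t - s, False)] []"
| refl: "T_word T w \<Longrightarrow> pres_rel T w w"
| sym: "pres_rel T u v \<Longrightarrow> pres_rel T v u"
| trans: "pres_rel T u v \<Longrightarrow> pres_rel T v w \<Longrightarrow> pres_rel T u w"
| ctxt: "T_word T a \<Longrightarrow> T_word T c \<Longrightarrow> pres_rel T u v \<Longrightarrow>
     pres_rel T (a @ u @ c) (a @ v @ c)"

definition pres_equiv :: "'b fag set \<Rightarrow> ('b word \<times> 'b word) set" where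
  "pres_equiv T = {(u, v). pres_rel T u v}"

definition U_group :: "'b fag set \<Rightarrow> ('b word set) monoid" where
  "U_group T = \<lparr>carrier = {w. T_word T w} // pres_equiv T,
     monoid.mult = (\<lambda>A B. pres_equiv T `` {(SOME u. u \<in> A) @ (SOME v. v \<in> B)}),
     monoid.one = pres_equiv T `` {[]}\<rparr>"

fun word_eval :: "'b word \<Rightarrow> 'b ext \<times> 'b fag \<times> int" where
  "word_eval [] = \<one>\<^bsub>amb_group\<^esub>"
| "word_eval ((t, b) # w) =
     (if b then weyl_gen t else inv\<^bsub>amb_group\<^esub> (weyl_gen t)) \<otimes>\<^bsub>amb_group\<^esub> word_eval w"

definition U_to_W :: "'b word set \<Rightarrow> 'b ext \<times> 'b fag \<times> int" where
  "U_to_W A = word_eval (SOME w. w \<in> A)"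

type_synonym 'b G2 = "'b \<Rightarrow>\<^sub>0 bit"

definition mod2 :: "'b fag \<Rightarrow> 'b G2" where
  "mod2 g = Poly_Mapping.map (\<lambda>n. of_int n) g"

definition scale2 :: "bit \<Rightarrow> ('a \<Rightarrow>\<^sub>0 bit) \<Rightarrow> ('a \<Rightarrow>\<^sub>0 bit)" where
  "scale2 c x = Poly_Mapping.map (\<lambda>a. c * a) x"

definition tensor2 :: "'b G2 \<Rightarrow> 'b G2 \<Rightarrow> ('b \<times> 'b) \<Rightarrow>\<^sub>0 bit" where
  "tensor2 x y = Abs_poly_mapping (\<lambda>(i, j). Poly_Mapping.lookup x i * Poly_Mapping.lookup y j)"

definition two_dependent :: "'b G2 set \<Rightarrow> bool" where
  "two_dependent M \<longleftrightarrow> module.dependent scale2 {tensor2 g g | g. g \<in> M}"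

definition two_independent :: "'b G2 set \<Rightarrow> bool" where
  "two_independent M \<longleftrightarrow> \<not> two_dependent M"

end

theory Submission
  imports Defs
begin

text \<open>
  Write \<open>x\<^sub>t\<close> for the generators of the presented group \<open>U\<close>. An element of \<open>U\<close> lying over \<open>(g, v)\<close>
  in \<open>G \<times> {1, -1}\<close> conjugates \<open>x\<^sub>s\<close> to \<open>x\<close> with index \<open>2g + vs\<close>, so the kernel of
  \<open>U \<rightarrow> G \<times> {1, -1}\<close> is central. Hence commutators of elements over \<open>(g, 1)\<close> and \<open>(h, 1)\<close> depend
  only on \<open>g \<and> h\<close> and give a homomorphism \<open>\<phi>\<close> from the exterior square to the centre of \<open>U\<close>, whose
  composite with \<open>U \<rightarrow> W\<close> is \<open>l \<mapsto> (2l, 0, 1)\<close>.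

  A word in which every class modulo \<open>2G\<close> occurs an even number of times can be brought to the form
  \<open>x\<^sub>2\<^sub>h x\<^sub>0 \<phi>(m)\<close>, which maps to \<open>(2m, 2h, 1)\<close>; so such a word is trivial in \<open>U\<close> as soon as it is
  trivial in \<open>W\<close>. On the other hand \<open>(l, g, v) \<mapsto> l + g \<otimes> g\<close> modulo 2 is a homomorphism on \<open>W\<close> mapping
  the generator of \<open>t\<close> to \<open>t \<otimes> t\<close>. Therefore the classes occurring an odd number of times in a
  word of the kernel form a 2-dependency, and 2-independence forces the kernel to be trivial.
  Conversely, representatives of a 2-dependency give a word with image \<open>(2m, 2h, 1)\<close>; dividing by
  \<open>x\<^sub>2\<^sub>h x\<^sub>0 \<phi>(m)\<close> yields a kernel element, which is not trivial because the parity with which a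
  class occurs is an invariant of \<open>U\<close>.
\<close>

section \<open>The exterior square and the ambient group\<close>

lemma zscale_eq_frag_cmul: "zscale v g = frag_cmul v g"
  by (rule poly_mapping_eqI) (simp add: zscale_def Poly_Mapping.map.rep_eq when_def)

lemma lookup_wedge:
  "Poly_Mapping.lookup (wedge g h) (i, j) =
     Poly_Mapping.lookup g i * Poly_Mapping.lookup h j - Poly_Mapping.lookup g j * Poly_Mapping.lookup h i"
proof -
  have "finite {x. (\<lambda>(i, j). Poly_Mapping.lookup g i * Poly_Mapping.lookup h j
      - Poly_Mapping.lookup g j * Poly_Mapping.lookup h i) x \<noteq> 0}"
    by (rule finite_subset[of _ "Poly_Mapping.keys g \<times> Poly_Mapping.keys h \<union> Poly_Mapping.keys h \<times> Poly_Mapping.keys g"])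
      (auto simp: in_keys_iff)
  then show ?thesis
    by (simp add: wedge_def)
qed

lemma wedge_add_left: "wedge (g + g') h = wedge g h + wedge g' h"
  by (rule poly_mapping_eqI) (auto simp: lookup_wedge lookup_add algebra_simps)

lemma wedge_add_right: "wedge g (h + h') = wedge g h + wedge g h'"
  by (rule poly_mapping_eqI) (auto simp: lookup_wedge lookup_add algebra_simps)

lemma wedge_cmul_left: "wedge (frag_cmul n g) h = frag_cmul n (wedge g h)"
  by (rule poly_mapping_eqI) (auto simp: lookup_wedge algebra_simps)

lemma wedge_cmul_right: "wedge g (frag_cmul n h) = frag_cmul n (wedge g h)"
  by (rule poly_mapping_eqI) (auto simp: lookup_wedge algebra_simps)

lemma wedge_self [simp]: "wedge g g = 0"
  by (rule poly_mapping_eqI) (auto simp: lookup_wedge algebra_simps)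

lemma wedge_zero_left [simp]: "wedge 0 h = 0"
  by (rule poly_mapping_eqI) (auto simp: lookup_wedge)

lemma wedge_zero_right [simp]: "wedge g 0 = 0"
  by (rule poly_mapping_eqI) (auto simp: lookup_wedge)

lemma wedge_uminus_left [simp]: "wedge (- g) h = - wedge g h"
  using wedge_cmul_left[of "-1" g h] by simp

lemma wedge_uminus_right [simp]: "wedge g (- h) = - wedge g h"
  using wedge_cmul_right[of g "-1" h] by simp

lemma wedge_diff_left [simp]: "wedge (g - g') h = wedge g h - wedge g' h"
  using wedge_add_left[of g "- g'" h] by simp

lemma wedge_diff_right [simp]: "wedge g (h - h') = wedge g h - wedge g h'"
  using wedge_add_right[of g h "- h'"] by simp

lemma wedge_swap: "wedge h g = - wedge g h"
  by (rule poly_mapping_eqI) (auto simp: lookup_wedge algebra_simps)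

lemma wedge_frag_of:
  "wedge (frag_of i) (frag_of j) = frag_of (i, j) - frag_of (j, i)"
proof (rule poly_mapping_eqI)
  fix p :: "'a \<times> 'a"
  obtain a b where "p = (a, b)" by (cases p)
  then show "Poly_Mapping.lookup (wedge (frag_of i) (frag_of j)) p
      = Poly_Mapping.lookup (frag_of (i, j) - frag_of (j, i)) p"
    by (cases "a = i"; cases "b = j"; cases "a = j"; cases "b = i") (simp_all add: lookup_wedge lookup_minus)
qed

lemma ext_group_eq: "ext_group = free_Abelian_group UNIV"
  by (simp add: ext_group_def free_Abelian_group_def)

lemma fag_group_eq: "fag_group = free_Abelian_group UNIV"
  by (simp add: fag_group_def free_Abelian_group_def)

lemma subgroup_ext_square: "subgroup ext_square (free_Abelian_group UNIV)"
  unfolding ext_square_def ext_group_eq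
  by (rule group.generate_is_subgroup) auto

lemma ext_square_add: "l \<in> ext_square \<Longrightarrow> l' \<in> ext_square \<Longrightarrow> l + l' \<in> ext_square"
  using subgroup.m_closed[OF subgroup_ext_square] by simp

lemma ext_square_zero: "0 \<in> ext_square"
  using subgroup.one_closed[OF subgroup_ext_square] by simp

lemma ext_square_uminus: "l \<in> ext_square \<Longrightarrow> - l \<in> ext_square"
  using subgroup.m_inv_closed[OF subgroup_ext_square, of l] by simp

lemma ext_square_diff: "l \<in> ext_square \<Longrightarrow> l' \<in> ext_square \<Longrightarrow> l - l' \<in> ext_square"
  using ext_square_add[of l "- l'"] ext_square_uminus[of l'] by simp

lemma ext_square_wedge: "wedge g h \<in> ext_square"
  unfolding ext_square_def by (rule generate.incl) auto

text \<open>The inverse of \<open>wedge g h\<close> is \<open>wedge h g\<close>, so the generating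
  set is closed under inversion and no case for inverses arises.\<close>

lemma ext_square_induct [consumes 1, case_names zero wedge add]:
  assumes "l \<in> ext_square"
    and "P 0"
    and "\<And>g h. P (wedge g h)"
    and "\<And>l l'. l \<in> ext_square \<Longrightarrow> l' \<in> ext_square \<Longrightarrow> P l \<Longrightarrow> P l' \<Longrightarrow> P (l + l')"
  shows "P l"
  using assms(1) unfolding ext_square_def
proof (induction rule: generate.induct)
  case one
  then show ?case using assms(2) by (simp add: ext_group_eq)
next
  case (incl h)
  then show ?case using assms(3) by auto
next
  case (inv h)
  then obtain g g' where "h = wedge g g'" by auto
  then have "inv\<^bsub>ext_group\<^esub> h = wedge g' g"
    by (simp add: ext_group_eq wedge_swap[of g' g])
  then show ?case using assms(3) by simp
next
  case (eng h1 h2)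
  then show ?case using assms(4)[of h1 h2] by (simp add: ext_group_eq ext_square_def)
qed

lemma hom_free_Abelian_group_ext:
  assumes "group H" "p \<in> hom (free_Abelian_group UNIV) H" "q \<in> hom (free_Abelian_group UNIV) H"
    and "\<And>b. p (frag_of b) = q (frag_of b)"
  shows "p x = q x"
proof -
  interpret p: group_hom "free_Abelian_group UNIV" H p
    using assms by (simp add: group_hom_def group_hom_axioms_def)
  interpret q: group_hom "free_Abelian_group UNIV" H q
    using assms by (simp add: group_hom_def group_hom_axioms_def)
  \<comment> \<open>\<open>frag_induction\<close> builds elements up by differences, so the
    agreement has to be carried along subtraction.\<close>
  have diff: "p (a - b) = p a \<otimes>\<^bsub>H\<^esub> inv\<^bsub>H\<^esub> p b" "q (a - b) = q a \<otimes>\<^bsub>H\<^esub> inv\<^bsub>H\<^esub> q b" for a b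
    using p.hom_mult[of a "- b"] p.hom_inv[of b] q.hom_mult[of a "- b"] q.hom_inv[of b] by simp_all
  show ?thesis
    by (rule frag_induction[of x UNIV])
      (use assms(4) p.hom_one q.hom_one in \<open>auto simp: diff\<close>)
qed

text \<open>The model of the exterior square consists of alternating matrices; a total order on the
  basis selects one entry from each pair of opposite ones.\<close>

lemma (in comm_group) wedge_universal:
  fixes c :: "'c fag \<Rightarrow> 'c fag \<Rightarrow> 'a"
  assumes closed: "\<And>g h. c g h \<in> carrier G"
    and left: "\<And>g g' h. c (g + g') h = c g h \<otimes> c g' h"
    and right: "\<And>g h h'. c g (h + h') = c g h \<otimes> c g h'"
    and alt: "\<And>g. c g g = \<one>"
  obtains f where "f \<in> hom (free_Abelian_group UNIV) G" "\<And>g h. f (wedge g h) = c g h"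
proof -
  \<comment> \<open>Expand \<open>c (g + h) (g + h)\<close>, which is trivial, by additivity in both
    arguments.\<close>
  have "c g h \<otimes> c h g = \<one>" for g h
    using left[of g h "g + h"] by (simp add: right alt closed)
  then have skew: "c h g = inv c g h" for g h
    using inv_equality[of "c h g" "c g h"] closed by simp
  obtain r :: "'c rel" where "well_order_on UNIV r"
    using well_order_on by blast
  then have tot: "total_on UNIV r" and anti: "antisym r"
    by (auto simp: well_order_on_def linear_order_on_def partial_order_on_def)
  \<comment> \<open>Of the two basis elements \<open>(i, j)\<close> and \<open>(j, i)\<close> in
    \<open>wedge (frag_of i) (frag_of j)\<close>, only the one lying in \<open>r\<close> keeps its
    value under \<open>c\<close>; skew-symmetry takes care of the other order.\<close>
  define k where "k = (\<lambda>(i, j). if (i, j) \<in> r \<and> i \<noteq> j then c (frag_of i) (frag_of j) else \<one>)"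
  have "k ` UNIV \<subseteq> carrier G"
    by (auto simp: k_def closed)
  then obtain f where f: "f \<in> hom (free_Abelian_group UNIV) G" "\<And>x. f (frag_of x) = k x"
    using free_Abelian_group_universal[of k UNIV] by auto
  interpret f: group_hom "free_Abelian_group UNIV" G f
    using f by (simp add: group_hom_def group_hom_axioms_def is_group)
  have f_closed: "f x \<in> carrier G" for x
    using f.hom_closed[of x] by simp
  have f_add: "f (x + y) = f x \<otimes> f y" for x y
    using f.hom_mult[of x y] by simp
  have f_diff: "f (x - y) = f x \<otimes> inv f y" for x y
    using f_add[of x "- y"] f.hom_inv[of y] by simp
  have basis: "f (wedge (frag_of i) (frag_of j)) = c (frag_of i) (frag_of j)" for i j
  proof (cases "i = j")
    case True
    then show ?thesis using f.hom_one alt by simp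
  next
    case False
    then consider "(i, j) \<in> r" "(j, i) \<notin> r" | "(j, i) \<in> r" "(i, j) \<notin> r"
      using tot anti by (metis UNIV_I antisymD total_on_def)
    then show ?thesis
    proof cases
      case 1
      with False show ?thesis by (simp add: wedge_frag_of f_diff f k_def closed)
    next
      case 2
      with False show ?thesis
        using skew[of "frag_of i" "frag_of j"]
        by (simp add: wedge_frag_of f_diff f k_def closed skew[of "frag_of j" "frag_of i"])
    qed
  qed
  have basis_left: "f (wedge (frag_of i) h) = c (frag_of i) h" for i h
    by (rule hom_free_Abelian_group_ext[of G "\<lambda>h. f (wedge (frag_of i) h)" "c (frag_of i)"])
      (auto simp: is_group hom_def closed right f_closed wedge_add_right f_add basis)
  have "f (wedge g h) = c g h" for g h
    by (rule hom_free_Abelian_group_ext[of G "\<lambda>g. f (wedge g h)" "\<lambda>g. c g h"])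
      (auto simp: is_group hom_def closed left f_closed wedge_add_left f_add basis_left)
  with f(1) show ?thesis using that by blast
qed

text \<open>The universal property, applied to \<open>wedge\<close> itself, yields a retraction
  \<open>f\<close> of all integer matrices onto the exterior square. Then
  \<open>f m + f m = m + m\<close>, and absence of torsion gives \<open>f m = m\<close>.\<close>

lemma ext_square_halve:
  fixes m :: "'b ext"
  assumes "m + m \<in> ext_square"
  shows "m \<in> ext_square"
proof -
  let ?A = "free_Abelian_group UNIV\<lparr>carrier := (ext_square :: 'b ext set)\<rparr>"
  interpret F: comm_group "free_Abelian_group (UNIV :: ('b \<times> 'b) set)"
    by (rule abelian_free_Abelian_group)
  interpret A: comm_group ?A
    using subgroup.subgroup_is_group[OF subgroup_ext_square F.is_group]
    by (rule group.group_comm_groupI) (auto simp: add.commute)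
  obtain f where f: "f \<in> hom (free_Abelian_group UNIV) ?A" "\<And>g h. f (wedge g h) = wedge g h"
    by (rule A.wedge_universal[of wedge])
      (auto simp: ext_square_wedge wedge_add_left wedge_add_right)
  have f_add: "f (x + y) = f x + f y" for x y
    using hom_mult[OF f(1), of x y] by simp
  have id: "f l = l" if "l \<in> ext_square" for l
    using that
  proof (induction rule: ext_square_induct)
    case zero
    then show ?case using f_add[of 0 0] by simp
  qed (auto simp: f f_add)
  have "f m + f m = m + m"
    using f_add[of m m] id[OF assms] by simp
  then have "f m = m"
    by (auto simp: poly_mapping_eq_iff fun_eq_iff lookup_add)
  moreover have "f m \<in> ext_square"
    using hom_in_carrier[OF f(1), of m] by simp
  ultimately show ?thesis by simp
qed

section \<open>The ambient group and the evaluation of words in it\<close>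

lemma carrier_amb_group: "carrier amb_group = {(l, g, v). l \<in> ext_square \<and> v \<in> {1, -1}}"
  by (simp add: amb_group_def)

lemma one_amb_group [simp]: "\<one>\<^bsub>amb_group\<^esub> = (0, 0, 1)"
  by (simp add: amb_group_def)

lemma mult_amb_group [simp]:
  "(l, g, v) \<otimes>\<^bsub>amb_group\<^esub> (l', g', v') =
     (l + l' + frag_cmul v (wedge g g'), g + frag_cmul v g', v * v')"
  by (simp add: amb_group_def zscale_eq_frag_cmul wedge_cmul_right)

lemma group_amb_group: "group amb_group"
proof (rule groupI)
  fix x y :: "'b ext \<times> 'b fag \<times> int" assume "x \<in> carrier amb_group" "y \<in> carrier amb_group"
  then show "x \<otimes>\<^bsub>amb_group\<^esub> y \<in> carrier amb_group"
    by (auto simp: carrier_amb_group ext_square_add ext_square_diff ext_square_wedge)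
next
  show "\<one>\<^bsub>amb_group\<^esub> \<in> carrier amb_group"
    by (simp add: carrier_amb_group ext_square_zero)
next
  fix x y z :: "'b ext \<times> 'b fag \<times> int"
  assume "x \<in> carrier amb_group" "y \<in> carrier amb_group" "z \<in> carrier amb_group"
  then show "x \<otimes>\<^bsub>amb_group\<^esub> y \<otimes>\<^bsub>amb_group\<^esub> z = x \<otimes>\<^bsub>amb_group\<^esub> (y \<otimes>\<^bsub>amb_group\<^esub> z)"
    by (auto simp: carrier_amb_group wedge_add_left wedge_add_right frag_cmul_distrib2
        wedge_cmul_left wedge_cmul_right algebra_simps)
next
  fix x :: "'b ext \<times> 'b fag \<times> int" assume "x \<in> carrier amb_group"
  then show "\<one>\<^bsub>amb_group\<^esub> \<otimes>\<^bsub>amb_group\<^esub> x = x"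
    by (auto simp: carrier_amb_group)
next
  fix x :: "'b ext \<times> 'b fag \<times> int" assume x: "x \<in> carrier amb_group"
  obtain l g v where [simp]: "x = (l, g, v)" by (cases x)
  \<comment> \<open>A left inverse because \<open>v * v = 1\<close> and the wedge term is a multiple
    of \<open>wedge g g\<close>.\<close>
  have "(- l, frag_cmul (- v) g, v) \<in> carrier amb_group" 
    "(- l, frag_cmul (- v) g, v) \<otimes>\<^bsub>amb_group\<^esub> x = \<one>\<^bsub>amb_group\<^esub>"
    using x by (auto simp: carrier_amb_group ext_square_uminus)
  then show "\<exists>y\<in>carrier amb_group. y \<otimes>\<^bsub>amb_group\<^esub> x = \<one>\<^bsub>amb_group\<^esub>"
    by blast
qed

interpretation amb: group amb_group
  by (rule group_amb_group)

lemma inv_amb_group: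
  assumes "(l, g, v) \<in> carrier amb_group"
  shows "inv\<^bsub>amb_group\<^esub> (l, g, v) = (- l, frag_cmul (- v) g, v)"
  using assms
  by (intro amb.inv_equality)
    (auto simp: carrier_amb_group ext_square_uminus)

lemma weyl_gen_closed: "weyl_gen t \<in> carrier amb_group"
  by (simp add: weyl_gen_def carrier_amb_group ext_square_zero)

lemma inv_weyl_gen: "inv\<^bsub>amb_group\<^esub> weyl_gen t = weyl_gen t"
  using weyl_gen_closed[of t] by (simp add: weyl_gen_def inv_amb_group)

text \<open>The elements \<open>weyl_gen t\<close> are involutions, so the flag distinguishing a
  letter from its inverse has no effect on the value.\<close>

lemma word_eval_Cons: "word_eval (x # w) = weyl_gen (fst x) \<otimes>\<^bsub>amb_group\<^esub> word_eval w"
  by (cases x) (simp add: inv_weyl_gen)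

lemma word_eval_closed: "word_eval w \<in> carrier amb_group"
proof (induction w)
  case Nil
  then show ?case by (simp add: carrier_amb_group ext_square_zero)
next
  case (Cons x w)
  then show ?case
    by (simp add: word_eval_Cons weyl_gen_closed del: word_eval.simps)
qed

lemma word_eval_append: "word_eval (u @ w) = word_eval u \<otimes>\<^bsub>amb_group\<^esub> word_eval w"
proof (induction u)
  case Nil
  show ?case using amb.l_one[OF word_eval_closed[of w]] by simp
next
  case (Cons x u)
  then show ?case
    by (simp add: word_eval_Cons weyl_gen_closed word_eval_closed amb.m_assoc del: word_eval.simps)
qed

text \<open>The elements \<open>weyl_gen t\<close> satisfy the defining relations; hence the value
  of \<open>U_to_W\<close> does not depend on the representative picked by
  \<open>SOME\<close>.\<close>

lemma word_eval_pres_rel: "pres_rel T u w \<Longrightarrow> word_eval u = word_eval w"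
proof (induction rule: pres_rel.induct)
  case (ctxt a c u v)
  then show ?case by (simp add: word_eval_append)
next
  case (rel_conj s t)
  then show ?case
    by (simp add: word_eval_Cons weyl_gen_def wedge_add_left wedge_add_right wedge_swap[of t s]
        del: word_eval.simps(2))
next
  case (free_cancel t b)
  then show ?case by (simp add: word_eval_Cons weyl_gen_def del: word_eval.simps(2))
next
  case (rel_square t)
  then show ?case by (simp add: word_eval_Cons weyl_gen_def del: word_eval.simps(2))
qed simp_all

section \<open>The presented group\<close>

context group
begin

lemma inv_mult_cancel_left: "a \<in> carrier G \<Longrightarrow> b \<in> carrier G \<Longrightarrow> inv a \<otimes> (a \<otimes> b) = b"
  by (simp add: m_assoc[symmetric])

lemma mult_inv_cancel_left: "a \<in> carrier G \<Longrightarrow> b \<in> carrier G \<Longrightarrow> a \<otimes> (inv a \<otimes> b) = b"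
  by (simp add: m_assoc[symmetric])

text \<open>As rewrite rules these associate products to the right, push inverses inwards and cancel
  adjacent inverse pairs.\<close>

lemmas group_normalize = m_assoc inv_mult_group inv_mult_cancel_left mult_inv_cancel_left

definition comm :: "'a \<Rightarrow> 'a \<Rightarrow> 'a" where
  "comm a b = a \<otimes> b \<otimes> inv a \<otimes> inv b"

lemma comm_closed: "a \<in> carrier G \<Longrightarrow> b \<in> carrier G \<Longrightarrow> comm a b \<in> carrier G"
  by (simp add: comm_def)

lemma comm_self: "a \<in> carrier G \<Longrightarrow> comm a a = \<one>"
  by (simp add: comm_def group_normalize)

lemma comm_eq_one:
  assumes "a \<in> carrier G" "b \<in> carrier G" "a \<otimes> b = b \<otimes> a"
  shows "comm a b = \<one>"
  unfolding comm_def assms(3) using assms(1,2) by (simp add: group_normalize)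

lemma mult_eq_comm: "a \<in> carrier G \<Longrightarrow> b \<in> carrier G \<Longrightarrow> a \<otimes> b = comm a b \<otimes> (b \<otimes> a)"
  by (simp add: comm_def group_normalize)

text \<open>In every group \<open>comm (a \<otimes> a') b\<close> is the conjugate of
  \<open>comm a' b\<close> by \<open>a\<close>, times \<open>comm a b\<close>; the commutation
  hypothesis removes the conjugation.\<close>

lemma comm_mult_left:
  assumes "a \<in> carrier G" "a' \<in> carrier G" "b \<in> carrier G"
    and "a \<otimes> comm a' b = comm a' b \<otimes> a"
  shows "comm (a \<otimes> a') b = comm a' b \<otimes> comm a b"
proof -
  have "comm (a \<otimes> a') b = (a \<otimes> comm a' b) \<otimes> (b \<otimes> inv a \<otimes> inv b)"
    using assms(1-3) by (simp add: comm_def group_normalize)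
  then show ?thesis
    using assms comm_closed[of a' b] by (simp add: comm_def[of a b] group_normalize)
qed

lemma comm_mult_right:
  assumes "a \<in> carrier G" "b \<in> carrier G" "b' \<in> carrier G"
    and "b \<otimes> comm a b' = comm a b' \<otimes> b"
  shows "comm a (b \<otimes> b') = comm a b \<otimes> comm a b'"
proof -
  have "comm a (b \<otimes> b') = comm a b \<otimes> (b \<otimes> comm a b') \<otimes> inv b"
    using assms(1-3) by (simp add: comm_def group_normalize)
  also have "\<dots> = comm a b \<otimes> comm a b' \<otimes> (b \<otimes> inv b)"
    unfolding assms(4) using assms comm_closed by (simp add: m_assoc)
  finally show ?thesis
    using assms comm_closed by simp
qed

end

section \<open>Words over \<open>T\<close> and the group formed by their classes\<close>

lemma T_word_append [simp]: "T_word T (u @ w) \<longleftrightarrow> T_word T u \<and> T_word T w"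
  by (auto simp: T_word_def)

lemma T_word_Cons [simp]: "T_word T (x # w) \<longleftrightarrow> fst x \<in> T \<and> T_word T w"
  by (auto simp: T_word_def)

lemma T_word_Nil [simp]: "T_word T []"
  by (auto simp: T_word_def)

locale reflection_space =
  fixes T :: "'b fag set"
  assumes generates: "generate fag_group T = UNIV"
    and zero_mem: "0 \<in> T"
    and reflect_mem: "\<And>g t. t \<in> T \<Longrightarrow> g + g - t \<in> T"
begin

lemma uminus_mem: "t \<in> T \<Longrightarrow> - t \<in> T"
  using reflect_mem[of t 0] by simp

lemma translate_mem: "t \<in> T \<Longrightarrow> g + g + t \<in> T"
  using reflect_mem[of "- t" g] uminus_mem[of t] by simp

lemma double_mem: "g + g \<in> T"
  using translate_mem[OF zero_mem] by simp

lemma pres_rel_T_word: "pres_rel T u w \<Longrightarrow> T_word T u \<and> T_word T w"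
  by (induction rule: pres_rel.induct) (simp_all add: reflect_mem)

abbreviation U :: "'b word set monoid" where
  "U \<equiv> U_group T"

definition cls :: "'b word \<Rightarrow> 'b word set" where
  "cls w = pres_equiv T `` {w}"

lemma mem_cls: "u \<in> cls w \<longleftrightarrow> pres_rel T w u"
  by (simp add: cls_def pres_equiv_def)

lemma cls_eq_iff:
  assumes "T_word T u"
  shows "cls u = cls w \<longleftrightarrow> pres_rel T u w"
proof
  assume "cls u = cls w"
  then show "pres_rel T u w"
    using assms mem_cls pres_rel.refl pres_rel.sym by blast
next
  assume "pres_rel T u w"
  then show "cls u = cls w"
    using mem_cls pres_rel.sym pres_rel.trans by blast
qed

lemma some_mem_cls: "T_word T w \<Longrightarrow> pres_rel T w (SOME u. u \<in> cls w)"
  by (metis mem_cls pres_rel.refl someI)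

lemma carrier_U: "carrier U = cls ` {w. T_word T w}"
  by (auto simp: U_group_def quotient_def cls_def)

lemma one_U: "\<one>\<^bsub>U\<^esub> = cls []"
  by (simp add: U_group_def cls_def)

text \<open>The relation is a congruence: \<open>ctxt\<close> replaces one factor at a time, so the
  representatives chosen by \<open>SOME\<close> do not matter.\<close>

lemma mult_cls:
  assumes "T_word T u" "T_word T w"
  shows "cls u \<otimes>\<^bsub>U\<^esub> cls w = cls (u @ w)"
proof -
  define u' w' where "u' = (SOME x. x \<in> cls u)" and "w' = (SOME x. x \<in> cls w)"
  have *: "pres_rel T u u'" "pres_rel T w w'"
    using assms some_mem_cls by (simp_all add: u'_def w'_def)
  then have "pres_rel T (u @ w) (u' @ w)" "pres_rel T (u' @ w) (u' @ w')"
    using pres_rel.ctxt[of T "[]" w u u'] pres_rel.ctxt[of T u' "[]" w w'] assms pres_rel_T_word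
    by auto
  then have "pres_rel T (u @ w) (u' @ w')"
    by (rule pres_rel.trans)
  then have "cls (u @ w) = cls (u' @ w')"
    using assms by (simp add: cls_eq_iff)
  then show ?thesis
    by (simp add: U_group_def u'_def w'_def cls_def)
qed

text \<open>The induction builds the reversed word with every flag flipped.\<close>

lemma cls_inverse:
  assumes "T_word T w"
  shows "\<exists>u. T_word T u \<and> pres_rel T (u @ w) []"
  using assms
proof (induction w)
  case Nil
  then show ?case using pres_rel.refl[of T "[]"] by (intro exI[of _ "[]"]) auto
next
  case (Cons x w)
  then obtain u where u: "T_word T u" "pres_rel T (u @ w) []" by auto
  obtain t b where x: "x = (t, b)" by (cases x)
  have "pres_rel T [(t, \<not> b), (t, b)] []"
    using pres_rel.free_cancel[of t T "\<not> b"] Cons.prems x by simp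
  then have "pres_rel T (u @ [(t, \<not> b), (t, b)] @ w) (u @ [] @ w)"
    using u Cons.prems by (intro pres_rel.ctxt) auto
  then have "pres_rel T ((u @ [(t, \<not> b)]) @ x # w) []"
    using u x pres_rel.trans by auto
  moreover have "T_word T (u @ [(t, \<not> b)])"
    using u Cons.prems x by simp
  ultimately show ?case by blast
qed

sublocale U: group U
proof (rule groupI)
  fix x assume "x \<in> carrier U"
  then obtain w where w: "x = cls w" "T_word T w" by (auto simp: carrier_U)
  then obtain u where u: "T_word T u" "pres_rel T (u @ w) []" using cls_inverse by blast
  then have "cls u \<otimes>\<^bsub>U\<^esub> x = \<one>\<^bsub>U\<^esub>"
    using w by (simp add: mult_cls one_U cls_eq_iff)
  then show "\<exists>y\<in>carrier U. y \<otimes>\<^bsub>U\<^esub> x = \<one>\<^bsub>U\<^esub>"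
    using u by (auto simp: carrier_U)
qed (auto simp: carrier_U mult_cls one_U)

lemma U_to_W_cls: "T_word T w \<Longrightarrow> U_to_W (cls w) = word_eval w"
  using some_mem_cls[of w] word_eval_pres_rel[of T w] by (simp add: U_to_W_def)

text \<open>The target is the whole ambient group here; that the image is exactly the Weyl group is
  shown by \<open>U_to_W_image\<close>.\<close>

lemma group_hom_U_to_W: "group_hom U amb_group U_to_W"
  by unfold_locales
    (auto simp: hom_def carrier_U U_to_W_cls mult_cls word_eval_closed word_eval_append)

lemmas U_to_W_simps [simp] = group_hom.hom_mult[OF group_hom_U_to_W] group_hom.hom_one[OF group_hom_U_to_W]
  group_hom.hom_inv[OF group_hom_U_to_W] group_hom.hom_closed[OF group_hom_U_to_W]

section \<open>Generators of the presented group and their conjugates\<close>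

definition \<xi> :: "'b fag \<Rightarrow> 'b word set" where
  "\<xi> t = cls [(t, True)]"

lemma \<xi>_closed [simp]: "t \<in> T \<Longrightarrow> \<xi> t \<in> carrier U"
  by (auto simp: \<xi>_def carrier_U)

lemma \<xi>_square: "t \<in> T \<Longrightarrow> \<xi> t \<otimes>\<^bsub>U\<^esub> \<xi> t = \<one>\<^bsub>U\<^esub>"
  using pres_rel.rel_square[of t T] by (simp add: \<xi>_def mult_cls one_U cls_eq_iff)

lemma inv_\<xi>: "t \<in> T \<Longrightarrow> inv\<^bsub>U\<^esub> \<xi> t = \<xi> t"
  by (intro U.inv_equality) (auto simp: \<xi>_square)

lemma cls_letter:
  assumes "t \<in> T"
  shows "cls [(t, b)] = \<xi> t"
proof (cases b)
  case False
  have "cls [(t, False)] \<otimes>\<^bsub>U\<^esub> \<xi> t = \<one>\<^bsub>U\<^esub>"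
    using assms pres_rel.free_cancel[of t T False] by (simp add: \<xi>_def mult_cls one_U cls_eq_iff)
  moreover have "cls [(t, False)] \<in> carrier U"
    using assms by (auto simp: carrier_U)
  ultimately have "cls [(t, False)] = inv\<^bsub>U\<^esub> \<xi> t"
    using assms U.inv_equality by force
  then show ?thesis using False assms inv_\<xi> by simp
qed (simp add: \<xi>_def)

lemma cls_Cons: "T_word T (x # w) \<Longrightarrow> cls (x # w) = \<xi> (fst x) \<otimes>\<^bsub>U\<^esub> cls w"
  using mult_cls[of "[x]" w] cls_letter[of "fst x" "snd x"] by simp

lemma cls_closed: "T_word T w \<Longrightarrow> cls w \<in> carrier U"
  by (auto simp: carrier_U)

lemma \<xi>_conj:
  assumes "t \<in> T" "s \<in> T"
  shows "\<xi> t \<otimes>\<^bsub>U\<^esub> \<xi> s \<otimes>\<^bsub>U\<^esub> \<xi> t = \<xi> (t + t - s)"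
proof -
  have m: "t + t - s \<in> T" using assms reflect_mem by blast
  have "cls [(t, True), (s, True), (t, False), (t + t - s, False)] = \<one>\<^bsub>U\<^esub>"
    using pres_rel.rel_conj[of s T t] assms m by (simp add: cls_eq_iff one_U)
  then have "\<xi> t \<otimes>\<^bsub>U\<^esub> \<xi> s \<otimes>\<^bsub>U\<^esub> \<xi> t \<otimes>\<^bsub>U\<^esub> \<xi> (t + t - s) = \<one>\<^bsub>U\<^esub>"
    using assms m by (simp add: cls_Cons U.m_assoc flip: one_U)
  then have "\<xi> t \<otimes>\<^bsub>U\<^esub> \<xi> s \<otimes>\<^bsub>U\<^esub> \<xi> t = inv\<^bsub>U\<^esub> \<xi> (t + t - s)"
    using assms m U.inv_equality[of _ "\<xi> (t + t - s)"] by simp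
  then show ?thesis using m inv_\<xi> by simp
qed

text \<open>By \<open>cls_letter\<close> a letter and its formal inverse have the same class, so
  left multiplication by generators alone reaches every element.\<close>

lemma U_induct [consumes 1, case_names one mult]:
  assumes "u \<in> carrier U"
    and "P \<one>\<^bsub>U\<^esub>"
    and "\<And>t u. t \<in> T \<Longrightarrow> u \<in> carrier U \<Longrightarrow> P u \<Longrightarrow> P (\<xi> t \<otimes>\<^bsub>U\<^esub> u)"
  shows "P u"
proof -
  have "P (cls w)" if "T_word T w" for w
    using that
  proof (induction w)
    case Nil
    then show ?case using assms(2) by (simp add: one_U)
  next
    case (Cons x w)
    then show ?case using assms(3)[of "fst x" "cls w"] by (simp add: cls_Cons cls_closed)
  qed
  then show ?thesis using assms(1) by (auto simp: carrier_U)
qed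

lemma U_to_W_\<xi>: "t \<in> T \<Longrightarrow> U_to_W (\<xi> t) = (0, t, -1)"
  by (simp add: \<xi>_def U_to_W_cls weyl_gen_def)

text \<open>The translation part and the sign of the action of \<^term>\<open>u\<close> on \<^term>\<open>T\<close> by
  \<open>s \<mapsto> 2 * tr u + sg u * s\<close>.\<close>

definition tr :: "'b word set \<Rightarrow> 'b fag" where
  "tr u = fst (snd (U_to_W u))"

definition sg :: "'b word set \<Rightarrow> int" where
  "sg u = snd (snd (U_to_W u))"

lemma U_to_W_split:
  assumes "u \<in> carrier U"
  obtains l where "l \<in> ext_square" "U_to_W u = (l, tr u, sg u)" "sg u = 1 \<or> sg u = -1"
proof -
  have "U_to_W u \<in> carrier amb_group" using assms by simp
  moreover obtain l g v where "U_to_W u = (l, g, v)" by (cases "U_to_W u")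
  ultimately show ?thesis using that by (auto simp: tr_def sg_def carrier_amb_group)
qed

lemma tr_mult:
  assumes "u \<in> carrier U" "w \<in> carrier U"
  shows "tr (u \<otimes>\<^bsub>U\<^esub> w) = tr u + frag_cmul (sg u) (tr w)"
  by (rule U_to_W_split[OF assms(1)], rule U_to_W_split[OF assms(2)])
    (simp add: assms tr_def[of "u \<otimes>\<^bsub>U\<^esub> w"] sg_def[of "u \<otimes>\<^bsub>U\<^esub> w"])

lemma sg_mult:
  assumes "u \<in> carrier U" "w \<in> carrier U"
  shows "sg (u \<otimes>\<^bsub>U\<^esub> w) = sg u * sg w"
  by (rule U_to_W_split[OF assms(1)], rule U_to_W_split[OF assms(2)])
    (simp add: assms tr_def[of "u \<otimes>\<^bsub>U\<^esub> w"] sg_def[of "u \<otimes>\<^bsub>U\<^esub> w"])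

lemma tr_one: "tr \<one>\<^bsub>U\<^esub> = 0" and sg_one: "sg \<one>\<^bsub>U\<^esub> = 1"
  by (simp_all add: tr_def sg_def)

lemma tr_\<xi>: "t \<in> T \<Longrightarrow> tr (\<xi> t) = t" and sg_\<xi>: "t \<in> T \<Longrightarrow> sg (\<xi> t) = -1"
  by (simp_all add: tr_def sg_def U_to_W_\<xi>)

lemma act_mem:
  assumes "u \<in> carrier U" "s \<in> T"
  shows "tr u + tr u + frag_cmul (sg u) s \<in> T"
  by (rule U_to_W_split[OF assms(1)])
    (use assms translate_mem[of s "tr u"] reflect_mem[of s "tr u"] in auto)

text \<open>The defining relation says that conjugation by a generator reflects the index of
  another. Composing such reflections follows the same rule as multiplying the pairs
  \<open>(tr u, sg u)\<close>.\<close>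

lemma conj_\<xi>:
  assumes "u \<in> carrier U" "s \<in> T"
  shows "u \<otimes>\<^bsub>U\<^esub> \<xi> s \<otimes>\<^bsub>U\<^esub> inv\<^bsub>U\<^esub> u = \<xi> (tr u + tr u + frag_cmul (sg u) s)"
  using assms(1)
proof (induction rule: U_induct)
  case one
  then show ?case using assms by (simp add: tr_one sg_one)
next
  case (mult t u)
  let ?s = "tr u + tr u + frag_cmul (sg u) s"
  have s: "?s \<in> T" using mult act_mem assms(2) by blast
  have "\<xi> t \<otimes>\<^bsub>U\<^esub> u \<otimes>\<^bsub>U\<^esub> \<xi> s \<otimes>\<^bsub>U\<^esub> inv\<^bsub>U\<^esub> (\<xi> t \<otimes>\<^bsub>U\<^esub> u)
      = \<xi> t \<otimes>\<^bsub>U\<^esub> (u \<otimes>\<^bsub>U\<^esub> \<xi> s \<otimes>\<^bsub>U\<^esub> inv\<^bsub>U\<^esub> u) \<otimes>\<^bsub>U\<^esub> \<xi> t"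
    using mult(1,2) assms(2) by (simp add: U.group_normalize inv_\<xi>)
  also have "\<dots> = \<xi> (t + t - ?s)"
    using mult s by (simp add: \<xi>_conj)
  also have "t + t - ?s = tr (\<xi> t \<otimes>\<^bsub>U\<^esub> u) + tr (\<xi> t \<otimes>\<^bsub>U\<^esub> u) + frag_cmul (sg (\<xi> t \<otimes>\<^bsub>U\<^esub> u)) s"
    using mult by (simp add: tr_mult sg_mult tr_\<xi> sg_\<xi> flip: minus_frag_cmul)
  finally show ?case .
qed

section \<open>Lifts of translations, their central commutators and the homomorphism
  \<open>phi\<close>\<close>

definition lifts :: "'b word set \<Rightarrow> 'b fag \<Rightarrow> bool" where
  "lifts u g \<longleftrightarrow> u \<in> carrier U \<and> tr u = g \<and> sg u = 1"

lemma lifts_closed: "lifts u g \<Longrightarrow> u \<in> carrier U"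
  by (simp add: lifts_def)

lemma lifts_one: "lifts \<one>\<^bsub>U\<^esub> 0"
  by (simp add: lifts_def tr_one sg_one)

lemma lifts_mult: "lifts u g \<Longrightarrow> lifts w h \<Longrightarrow> lifts (u \<otimes>\<^bsub>U\<^esub> w) (g + h)"
  by (simp add: lifts_def tr_mult sg_mult)

lemma lifts_inv:
  assumes "lifts u g"
  shows "lifts (inv\<^bsub>U\<^esub> u) (- g)"
proof -
  have u: "u \<in> carrier U" "tr u = g" "sg u = 1" using assms by (auto simp: lifts_def)
  have "g + tr (inv\<^bsub>U\<^esub> u) = 0" "sg (inv\<^bsub>U\<^esub> u) = 1"
    using tr_mult[of u "inv\<^bsub>U\<^esub> u"] sg_mult[of u "inv\<^bsub>U\<^esub> u"] u by (simp_all add: tr_one sg_one)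
  then show ?thesis
    using u minus_unique[of g] by (auto simp: lifts_def)
qed

text \<open>For translation part 0 and sign 1, \<open>conj_\<xi>\<close> says that conjugation by
  \<open>z\<close> fixes every generator.\<close>

lemma lifts_zero_central:
  assumes "lifts z 0" "u \<in> carrier U"
  shows "u \<otimes>\<^bsub>U\<^esub> z = z \<otimes>\<^bsub>U\<^esub> u"
  using assms(2)
proof (induction rule: U_induct)
  case one
  then show ?case using assms by (simp add: lifts_def)
next
  case (mult t u)
  have z: "z \<in> carrier U" using assms lifts_closed by blast
  have "z \<otimes>\<^bsub>U\<^esub> \<xi> t \<otimes>\<^bsub>U\<^esub> inv\<^bsub>U\<^esub> z = \<xi> t"
    using conj_\<xi>[of z t] mult assms by (simp add: lifts_def)
  then have zt: "z \<otimes>\<^bsub>U\<^esub> \<xi> t = \<xi> t \<otimes>\<^bsub>U\<^esub> z"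
    using z mult by (metis U.inv_solve_right' U.m_closed \<xi>_closed)
  show ?case
    using mult z zt by (metis U.m_assoc \<xi>_closed)
qed

lemma lifts_exists: "\<exists>u. lifts u g"
proof -
  \<comment> \<open>Multiplying by \<open>\<xi> 0\<close> corrects the sign of
    \<open>\<xi> t\<close> without changing its translation part.\<close>
  have T: "\<exists>u. lifts u t" if "t \<in> T" for t
    using that zero_mem
    by (intro exI[of _ "\<xi> t \<otimes>\<^bsub>U\<^esub> \<xi> 0"]) (simp add: lifts_def tr_mult sg_mult tr_\<xi> sg_\<xi>)
  have "g \<in> generate fag_group T" using generates by simp
  then show ?thesis
  proof (induction rule: generate.induct)
    case one
    then show ?case using lifts_one by (auto simp: fag_group_eq)
  next
    case (incl h)
    then show ?case using T by blast
  next
    case (inv h)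
    then show ?case using T[of h] lifts_inv by (auto simp: fag_group_eq)
  next
    case (eng g h)
    then obtain u w where "lifts u g" "lifts w h" by blast
    then show ?case using lifts_mult[of u g w h] by (auto simp: fag_group_eq)
  qed
qed

text \<open>Lifts of \<open>g\<close> differ by central elements, so the commutator does not depend on them.\<close>

definition c :: "'b fag \<Rightarrow> 'b fag \<Rightarrow> 'b word set" where
  "c g h = U.comm (SOME u. lifts u g) (SOME u. lifts u h)"

lemma lifts_comm:
  assumes "lifts u g" "lifts w h"
  shows "lifts (U.comm u w) 0"
  using lifts_mult[OF lifts_mult[OF lifts_mult[OF assms] lifts_inv[OF assms(1)]] lifts_inv[OF assms(2)]]
  by (simp add: U.comm_def)

lemma comm_lifts_cong:
  assumes "lifts u g" "lifts u' g" "lifts w h"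
  shows "U.comm u w = U.comm u' w" "U.comm w u = U.comm w u'"
proof -
  define z where "z = inv\<^bsub>U\<^esub> u \<otimes>\<^bsub>U\<^esub> u'"
  have [simp]: "u \<in> carrier U" "u' \<in> carrier U" "w \<in> carrier U"
    using assms lifts_closed by blast+
  have z: "lifts z 0"
    using lifts_mult[OF lifts_inv[OF assms(1)] assms(2)] by (simp add: z_def)
  then have [simp]: "z \<in> carrier U" using lifts_closed by blast
  have u': "u' = u \<otimes>\<^bsub>U\<^esub> z"
    by (simp add: z_def U.mult_inv_cancel_left)
  have triv: "U.comm z w = \<one>\<^bsub>U\<^esub>" "U.comm w z = \<one>\<^bsub>U\<^esub>"
    using lifts_zero_central[OF z, of w] by (simp_all add: U.comm_eq_one)
  show "U.comm u w = U.comm u' w" "U.comm w u = U.comm w u'"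
    using U.comm_mult_left[of u z w] U.comm_mult_right[of w u z] triv
    by (simp_all add: u' U.comm_closed)
qed

lemma comm_eq_c:
  assumes "lifts u g" "lifts w h"
  shows "U.comm u w = c g h"
proof -
  have "lifts (SOME u. lifts u g) g" "lifts (SOME u. lifts u h) h"
    using lifts_exists by (auto intro: someI_ex)
  then show ?thesis
    using comm_lifts_cong(1)[OF assms(1) _ assms(2)] comm_lifts_cong(2)[OF assms(2)]
    unfolding c_def by simp
qed

lemma lifts_c: "lifts (c g h) 0"
  by (metis comm_eq_c lifts_comm lifts_exists)

lemma c_closed: "c g h \<in> carrier U"
  using lifts_c lifts_closed by blast

lemma c_add_left: "c (g + g') h = c g h \<otimes>\<^bsub>U\<^esub> c g' h"
proof -
  obtain u u' w where l: "lifts u g" "lifts u' g'" "lifts w h"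
    using lifts_exists by metis
  then have "U.comm (u \<otimes>\<^bsub>U\<^esub> u') w = U.comm u' w \<otimes>\<^bsub>U\<^esub> U.comm u w"
    by (intro U.comm_mult_left lifts_zero_central lifts_comm[of u' g' w h]) (auto intro: lifts_closed)
  then show ?thesis
    using l lifts_mult[OF l(1,2)] lifts_zero_central[OF lifts_c c_closed] by (simp add: comm_eq_c)
qed

lemma c_add_right: "c g (h + h') = c g h \<otimes>\<^bsub>U\<^esub> c g h'"
proof -
  obtain u w w' where l: "lifts u g" "lifts w h" "lifts w' h'"
    using lifts_exists by metis
  then have "U.comm u (w \<otimes>\<^bsub>U\<^esub> w') = U.comm u w \<otimes>\<^bsub>U\<^esub> U.comm u w'"
    by (intro U.comm_mult_right lifts_zero_central lifts_comm[of u g w' h']) (auto intro: lifts_closed)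
  then show ?thesis
    using l lifts_mult[OF l(2,3)] by (simp add: comm_eq_c)
qed

lemma c_self: "c g g = \<one>\<^bsub>U\<^esub>"
  by (metis U.comm_self comm_eq_c lifts_closed lifts_exists)

text \<open>The elements over \<open>(0, 1)\<close> form a commutative group by centrality, and
  \<open>c\<close> is an alternating biadditive map into it, so \<open>wedge_universal\<close>
  applies. The resulting map is additive on all integer matrices, but \<open>c\<close> describes it
  only on the exterior square.\<close>

lemma phi_exists:
  "\<exists>f :: 'b ext \<Rightarrow> 'b word set. (\<forall>l. lifts (f l) 0) \<and> (\<forall>l l'. f (l + l') = f l \<otimes>\<^bsub>U\<^esub> f l')
     \<and> (\<forall>g h. f (wedge g h) = c g h)"
proof -
  let ?Z = "U\<lparr>carrier := {z. lifts z 0}\<rparr>"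
  have "subgroup {z. lifts z 0} U"
  proof (rule U.subgroupI)
    show "{z. lifts z 0} \<noteq> {}" using lifts_one by blast
  qed (use lifts_inv[of _ 0] lifts_mult[of _ 0 _ 0] lifts_closed in auto)
  then interpret Z: group ?Z
    using subgroup.subgroup_is_group U.is_group by blast
  interpret Z: comm_group ?Z
    by (rule Z.group_comm_groupI) (simp add: lifts_zero_central lifts_closed)
  obtain f where "f \<in> hom (free_Abelian_group UNIV) ?Z" "\<And>g h. f (wedge g h) = c g h"
    by (rule Z.wedge_universal[of c]) (auto simp: lifts_c c_add_left c_add_right c_self)
  then show ?thesis
    by (intro exI[of _ f]) (auto simp: hom_def Pi_def)
qed

definition phi :: "'b ext \<Rightarrow> 'b word set" where
  "phi = (SOME f. (\<forall>l. lifts (f l) 0) \<and> (\<forall>l l'. f (l + l') = f l \<otimes>\<^bsub>U\<^esub> f l')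
     \<and> (\<forall>g h. f (wedge g h) = c g h))"

lemma lifts_phi: "lifts (phi l) 0"
  and phi_add: "phi (l + l') = phi l \<otimes>\<^bsub>U\<^esub> phi l'"
  and phi_wedge: "phi (wedge g h) = c g h"
  using someI_ex[OF phi_exists, folded phi_def] by simp_all

lemma phi_closed [simp]: "phi l \<in> carrier U"
  using lifts_phi lifts_closed by blast

lemma phi_zero: "phi 0 = \<one>\<^bsub>U\<^esub>"
  using phi_add[of 0 0] phi_closed[of 0] by simp

lemma phi_central: "u \<in> carrier U \<Longrightarrow> u \<otimes>\<^bsub>U\<^esub> phi l = phi l \<otimes>\<^bsub>U\<^esub> u"
  using lifts_zero_central[OF lifts_phi] .

text \<open>For lifts \<open>u\<close> and \<open>w\<close>, the first components of their images
  cancel in the commutator; what remains is \<open>wedge g h - wedge h g\<close>, twice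
  \<open>wedge g h\<close>.\<close>

lemma U_to_W_c: "U_to_W (c g h) = (wedge g h + wedge g h, 0, 1)"
proof -
  obtain u w where uw: "lifts u g" "lifts w h" using lifts_exists by metis
  then have cl: "u \<in> carrier U" "w \<in> carrier U" using lifts_closed by blast+
  obtain k where k: "k \<in> ext_square" "U_to_W u = (k, g, 1)"
    using U_to_W_split[OF cl(1)] uw by (metis lifts_def)
  obtain l where l: "l \<in> ext_square" "U_to_W w = (l, h, 1)"
    using U_to_W_split[OF cl(2)] uw by (metis lifts_def)
  have "c g h = U.comm u w" using comm_eq_c uw by simp
  then show ?thesis
    using k l cl
    by (simp add: U.comm_def inv_amb_group carrier_amb_group wedge_add_left wedge_swap[of h g])
qed

lemma U_to_W_phi: "l \<in> ext_square \<Longrightarrow> U_to_W (phi l) = (l + l, 0, 1)"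
proof (induction rule: ext_square_induct)
  case (add l l')
  then show ?case by (simp add: phi_add algebra_simps)
qed (simp_all add: phi_zero phi_wedge U_to_W_c)

section \<open>Distinguished lifts of doubled elements and their products\<close>

definition q :: "'b fag \<Rightarrow> 'b word set" where
  "q h = \<xi> (h + h) \<otimes>\<^bsub>U\<^esub> \<xi> 0"

lemma q_closed [simp]: "q h \<in> carrier U"
  by (simp add: q_def double_mem zero_mem)

lemma lifts_q: "lifts (q h) (h + h)"
  using q_closed[of h] unfolding q_def lifts_def
  by (simp add: tr_mult sg_mult tr_\<xi> sg_\<xi> double_mem zero_mem)

lemma U_to_W_q: "U_to_W (q h) = (0, h + h, 1)"
  by (simp add: q_def U_to_W_\<xi> double_mem zero_mem)

text \<open>Conjugating \<open>\<xi> 0\<close> by \<open>u\<close> gives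
  \<open>\<xi> (h + h)\<close>. As \<open>\<xi> 0\<close> is its own inverse, \<open>q h\<close> is
  thus the commutator of \<open>u\<close> and \<open>\<xi> 0\<close>.\<close>

lemma q_eq:
  assumes "lifts u h"
  shows "q h = u \<otimes>\<^bsub>U\<^esub> \<xi> 0 \<otimes>\<^bsub>U\<^esub> inv\<^bsub>U\<^esub> u \<otimes>\<^bsub>U\<^esub> \<xi> 0"
  using conj_\<xi>[of u 0] assms zero_mem by (simp add: q_def lifts_def)

lemma q_mult: "q h \<otimes>\<^bsub>U\<^esub> q h' = q (h + h') \<otimes>\<^bsub>U\<^esub> phi (wedge h h' + wedge h h')"
proof -
  obtain u u' where l: "lifts u h" "lifts u' h'" using lifts_exists by metis
  have [simp]: "u \<in> carrier U" "u' \<in> carrier U" "\<xi> 0 \<in> carrier U"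
    using l lifts_closed zero_mem by auto
  have cancel: "\<xi> 0 \<otimes>\<^bsub>U\<^esub> (\<xi> 0 \<otimes>\<^bsub>U\<^esub> w) = w" if "w \<in> carrier U" for w
    using that \<xi>_square[OF zero_mem] by (simp flip: U.m_assoc)
  \<comment> \<open>The expansion of the commutator of \<open>u \<otimes> u'\<close> with
    \<open>\<xi> 0\<close>: the commutator with \<open>u'\<close>, conjugated by \<open>u\<close>,
    times the commutator with \<open>u\<close>.\<close>
  have "q (h + h') = u \<otimes>\<^bsub>U\<^esub> q h' \<otimes>\<^bsub>U\<^esub> inv\<^bsub>U\<^esub> u \<otimes>\<^bsub>U\<^esub> q h"
    unfolding q_eq[OF l(1)] q_eq[OF l(2)] q_eq[OF lifts_mult[OF l]]
    by (simp add: U.group_normalize cancel)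
  also have "\<dots> = U.comm u (q h') \<otimes>\<^bsub>U\<^esub> (q h' \<otimes>\<^bsub>U\<^esub> q h)"
    by (simp add: U.comm_def U.group_normalize)
  also have "\<dots> = c h (h' + h') \<otimes>\<^bsub>U\<^esub> (c (h' + h') (h + h) \<otimes>\<^bsub>U\<^esub> (q h \<otimes>\<^bsub>U\<^esub> q h'))"
    using U.mult_eq_comm[of "q h'" "q h"] comm_eq_c[OF l(1) lifts_q] comm_eq_c[OF lifts_q lifts_q]
    by simp
  also have "\<dots> = phi (wedge h (h' + h') + wedge (h' + h') (h + h)) \<otimes>\<^bsub>U\<^esub> (q h \<otimes>\<^bsub>U\<^esub> q h')"
    by (simp add: phi_add U.m_assoc flip: phi_wedge)
  \<comment> \<open>The two summands contribute 2 and -4 times \<open>wedge h h'\<close>.\<close>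
  also have "wedge h (h' + h') + wedge (h' + h') (h + h) = - (wedge h h' + wedge h h')"
    by (simp add: wedge_add_left wedge_add_right wedge_swap[of h' h])
  finally have e: "q (h + h') = phi (- (wedge h h' + wedge h h')) \<otimes>\<^bsub>U\<^esub> (q h \<otimes>\<^bsub>U\<^esub> q h')" .
  have "q (h + h') \<otimes>\<^bsub>U\<^esub> phi (wedge h h' + wedge h h')
     = phi (wedge h h' + wedge h h' + - (wedge h h' + wedge h h')) \<otimes>\<^bsub>U\<^esub> (q h \<otimes>\<^bsub>U\<^esub> q h')"
    unfolding phi_central[OF q_closed] phi_add[of "wedge h h' + wedge h h'" "- (wedge h h' + wedge h h')"]
    by (subst e) (simp add: U.m_assoc)
  then show ?thesis by (simp add: phi_zero)
qed

text \<open>Two adjacent letters of the same class modulo 2 collapse to a distinguished lift and a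
  central factor; this is the reduction step of the normal form.\<close>

lemma \<xi>_translate_mult_\<xi>:
  assumes "t \<in> T"
  shows "\<xi> (h + h + t) \<otimes>\<^bsub>U\<^esub> \<xi> t = q h \<otimes>\<^bsub>U\<^esub> phi (wedge t h)"
proof -
  obtain u where l: "lifts u h" using lifts_exists by metis
  define a where "a = \<xi> t \<otimes>\<^bsub>U\<^esub> \<xi> 0"
  have [simp]: "u \<in> carrier U" "\<xi> 0 \<in> carrier U" "\<xi> t \<in> carrier U"
    using l lifts_closed zero_mem assms by auto
  have [simp]: "a \<in> carrier U" by (simp add: a_def)
  have la: "lifts a t"
    using assms zero_mem by (simp add: a_def lifts_def tr_mult sg_mult tr_\<xi> sg_\<xi>)
  \<comment> \<open>Using one form of \<open>\<xi> t\<close> on each side gives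
    \<open>u a \<xi> 0 (inv u) \<xi> 0 (inv a)\<close>. Moving \<open>u\<close> past
    \<open>a\<close> costs \<open>comm u a\<close> and leaves \<open>q h\<close> conjugated by
    \<open>a\<close>.\<close>
  have refl_eq: "\<xi> t = a \<otimes>\<^bsub>U\<^esub> \<xi> 0" "\<xi> t = \<xi> 0 \<otimes>\<^bsub>U\<^esub> inv\<^bsub>U\<^esub> a"
    using assms zero_mem \<xi>_square[of 0]
    by (simp_all add: a_def U.m_assoc U.inv_mult_group inv_\<xi> flip: U.m_assoc[of "\<xi> 0" "\<xi> 0" "\<xi> t"])
  have "\<xi> (h + h + t) \<otimes>\<^bsub>U\<^esub> \<xi> t = u \<otimes>\<^bsub>U\<^esub> \<xi> t \<otimes>\<^bsub>U\<^esub> inv\<^bsub>U\<^esub> u \<otimes>\<^bsub>U\<^esub> \<xi> t"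
    using conj_\<xi>[of u t] l assms by (simp add: lifts_def)
  also have "\<dots> = u \<otimes>\<^bsub>U\<^esub> (a \<otimes>\<^bsub>U\<^esub> \<xi> 0) \<otimes>\<^bsub>U\<^esub> inv\<^bsub>U\<^esub> u \<otimes>\<^bsub>U\<^esub> (\<xi> 0 \<otimes>\<^bsub>U\<^esub> inv\<^bsub>U\<^esub> a)"
    by (simp only: refl_eq[symmetric])
  also have "\<dots> = U.comm u a \<otimes>\<^bsub>U\<^esub> (U.comm a (q h) \<otimes>\<^bsub>U\<^esub> q h)"
    unfolding U.comm_def by (simp add: U.group_normalize) (simp add: q_eq[OF l] U.group_normalize)
  also have "\<dots> = phi (wedge h t + wedge t (h + h)) \<otimes>\<^bsub>U\<^esub> q h"
    using comm_eq_c[OF l la] comm_eq_c[OF la lifts_q[of h]] by (simp add: phi_add U.m_assoc flip: phi_wedge)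
  also have "wedge h t + wedge t (h + h) = wedge t h"
    by (simp add: wedge_add_right wedge_swap[of h t])
  finally show ?thesis by (simp add: phi_central)
qed

end


section \<open>Reduction modulo 2\<close>

lemma of_nat_bit: "(of_nat n :: bit) = of_bool (odd n)"
  by (induction n) auto

lemma of_int_bit: "(of_int n :: bit) = of_bool (odd n)"
  by (cases "even n") (auto elim!: evenE oddE)

lemma lookup_mod2: "Poly_Mapping.lookup (mod2 g) b = of_int (Poly_Mapping.lookup g b)"
  by (simp add: mod2_def Poly_Mapping.map.rep_eq when_def)

lemma lookup_scale2: "Poly_Mapping.lookup (scale2 a x) b = a * Poly_Mapping.lookup x b"
  by (simp add: scale2_def Poly_Mapping.map.rep_eq when_def)

lemma lookup_tensor2:
  "Poly_Mapping.lookup (tensor2 x y) (i, j) = Poly_Mapping.lookup x i * Poly_Mapping.lookup y j"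
proof -
  have "finite {p. (\<lambda>(i, j). Poly_Mapping.lookup x i * Poly_Mapping.lookup y j) p \<noteq> 0}"
    by (rule finite_subset[of _ "Poly_Mapping.keys x \<times> Poly_Mapping.keys y"]) (auto simp: in_keys_iff)
  then show ?thesis
    by (simp add: tensor2_def)
qed

text \<open>Every bit equals its own square, so the diagonal of \<open>tensor2 x x\<close> recovers
  \<open>x\<close>.\<close>

lemma tensor2_self_inject: "tensor2 x x = tensor2 y y \<Longrightarrow> x = y"
proof (rule poly_mapping_eqI)
  fix i assume "tensor2 x x = tensor2 y y"
  then have "Poly_Mapping.lookup x i * Poly_Mapping.lookup x i = Poly_Mapping.lookup y i * Poly_Mapping.lookup y i"
    by (metis lookup_tensor2)
  then show "Poly_Mapping.lookup x i = Poly_Mapping.lookup y i"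
    by (cases "Poly_Mapping.lookup x i"; cases "Poly_Mapping.lookup y i") simp_all
qed

lemma halve_exists:
  fixes g :: "'a \<Rightarrow>\<^sub>0 int"
  assumes "\<And>b. even (Poly_Mapping.lookup g b)"
  shows "\<exists>h. g = h + h"
proof
  show "g = Poly_Mapping.map (\<lambda>n. n div 2) g + Poly_Mapping.map (\<lambda>n. n div 2) g"
  proof (rule poly_mapping_eqI)
    fix b
    show "Poly_Mapping.lookup g b
        = Poly_Mapping.lookup (Poly_Mapping.map (\<lambda>n. n div 2) g + Poly_Mapping.map (\<lambda>n. n div 2) g) b"
      using assms[of b] by (auto simp: lookup_add Poly_Mapping.map.rep_eq when_def)
  qed
qed

lemma mod2_translate: "mod2 (h + h + t) = mod2 t"
  by (rule poly_mapping_eqI) (simp add: lookup_mod2 lookup_add of_int_bit)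

lemma mod2_reflect: "mod2 (h + h - t) = mod2 t"
  by (rule poly_mapping_eqI) (simp add: lookup_mod2 lookup_add lookup_minus of_int_bit)

lemma mod2_uminus: "mod2 (- t) = mod2 t"
  using mod2_reflect[of 0 t] by simp

lemma mod2_zero: "mod2 0 = 0"
  by (rule poly_mapping_eqI) (simp add: lookup_mod2)

lemma mod2_eqE:
  assumes "mod2 s = mod2 t"
  obtains h where "s = h + h + t"
proof -
  have "even (Poly_Mapping.lookup (s - t) b)" for b
  proof -
    have "(of_int (Poly_Mapping.lookup s b) :: bit) = of_int (Poly_Mapping.lookup t b)"
      using assms by (metis lookup_mod2)
    then show ?thesis by (auto simp: of_int_bit lookup_minus split: if_splits)
  qed
  then obtain h where "s - t = h + h" using halve_exists by blast
  then show ?thesis using that[of h] by (simp add: algebra_simps)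
qed

text \<open>A nonzero coefficient over the field with two elements is 1, so a linear relation is
  just a vanishing finite sum; injectivity of the tensor square moves it from tensors back to
  \<open>M\<close>.\<close>

lemma two_dependent_iff:
  "two_dependent M \<longleftrightarrow> (\<exists>F. finite F \<and> F \<noteq> {} \<and> F \<subseteq> M \<and> (\<Sum>r\<in>F. tensor2 r r) = 0)"
proof -
  interpret Modules.module "scale2 :: bit \<Rightarrow> ('a \<times> 'a \<Rightarrow>\<^sub>0 bit) \<Rightarrow> _"
    by unfold_locales (auto intro!: poly_mapping_eqI simp: lookup_scale2 lookup_add algebra_simps)
  have inj: "inj_on (\<lambda>r. tensor2 r r) F" for F :: "'a G2 set"
    by (auto simp: inj_on_def dest: tensor2_self_inject)
  have img: "{tensor2 g g | g. g \<in> M} = (\<lambda>r. tensor2 r r) ` M"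
    by auto
  show ?thesis
    unfolding two_dependent_def img
  proof
    assume "dependent ((\<lambda>r. tensor2 r r) ` M)"
    then obtain S u where S: "finite S" "S \<subseteq> (\<lambda>r. tensor2 r r) ` M"
      "(\<Sum>v\<in>S. scale2 (u v) v) = 0" "\<exists>v\<in>S. u v \<noteq> 0"
      by (auto simp: dependent_explicit)
    define S' where "S' = {v \<in> S. u v \<noteq> 0}"
    have "(\<Sum>v\<in>S'. v) = (\<Sum>v\<in>S. scale2 (u v) v)"
      unfolding S'_def
    proof (rule sum.mono_neutral_cong_left)
      show "\<forall>i\<in>S - {v \<in> S. u v \<noteq> 0}. scale2 (u i) i = 0"
        by auto
      show "x = scale2 (u x) x" if "x \<in> {v \<in> S. u v \<noteq> 0}" for x
        using that by (auto simp: bit_not_zero_iff)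
    qed (use S in auto)
    moreover obtain F where F: "F \<subseteq> M" "S' = (\<lambda>r. tensor2 r r) ` F"
      using S(2) unfolding S'_def by (metis (no_types, lifting) mem_Collect_eq subset_iff subset_imageE)
    moreover have "finite F"
    proof (rule finite_imageD[OF _ inj])
      show "finite ((\<lambda>r. tensor2 r r) ` F)"
        using F(2) S(1) by (simp add: S'_def flip: F(2))
    qed
    moreover have "F \<noteq> {}"
      using S(4) F by (auto simp: S'_def)
    ultimately show "\<exists>F. finite F \<and> F \<noteq> {} \<and> F \<subseteq> M \<and> (\<Sum>r\<in>F. tensor2 r r) = 0"
      using S(3) by (intro exI[of _ F]) (simp add: sum.reindex[OF inj])
  next
    assume "\<exists>F. finite F \<and> F \<noteq> {} \<and> F \<subseteq> M \<and> (\<Sum>r\<in>F. tensor2 r r) = 0"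
    then obtain F where F: "finite F" "F \<noteq> {}" "F \<subseteq> M" "(\<Sum>r\<in>F. tensor2 r r) = 0" by blast
    then have "finite ((\<lambda>r. tensor2 r r) ` F)" "(\<lambda>r. tensor2 r r) ` F \<subseteq> (\<lambda>r. tensor2 r r) ` M"
      "(\<Sum>v\<in>(\<lambda>r. tensor2 r r) ` F. scale2 1 v) = 0" "\<exists>v\<in>(\<lambda>r. tensor2 r r) ` F. (1::bit) \<noteq> 0"
      by (auto simp: sum.reindex[OF inj])
    then show "dependent ((\<lambda>r. tensor2 r r) ` M)"
      unfolding dependent_explicit by (intro exI[of _ "(\<lambda>r. tensor2 r r) ` F"] exI[of _ "\<lambda>_. 1"]) simp
  qed
qed

section \<open>Parities of the classes modulo 2 occurring in a word\<close>

definition mod2_word :: "'b word \<Rightarrow> 'b G2 list" where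
  "mod2_word w = map (\<lambda>x. mod2 (fst x)) w"

lemma mod2_word_simps [simp]:
  "mod2_word [] = []" "mod2_word (x # w) = mod2 (fst x) # mod2_word w" "mod2_word (u @ w) = mod2_word u @ mod2_word w"
  by (simp_all add: mod2_word_def)

text \<open>Each defining relator contains every class an even number of times; for
  \<open>rel_conj\<close> this holds because \<open>t + t - s\<close> and \<open>s\<close> have the
  same class.\<close>

lemma even_count_mod2_word_pres_rel:
  "pres_rel T u w \<Longrightarrow> even (count_list (mod2_word u) r) \<longleftrightarrow> even (count_list (mod2_word w) r)"
  by (induction rule: pres_rel.induct) (auto simp: mod2_reflect)

lemma count_list_distinct: "distinct xs \<Longrightarrow> x \<in> set xs \<Longrightarrow> count_list xs x = 1"
  by (induction xs) auto

lemma sum_list_map_eq_sum_of_nat_count: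
  fixes f :: "'x \<Rightarrow> 'a :: comm_semiring_1"
  assumes "finite A" "set xs \<subseteq> A"
  shows "sum_list (map f xs) = (\<Sum>x\<in>A. of_nat (count_list xs x) * f x)"
  using assms(2)
proof (induction xs)
  case (Cons y xs)
  have "(\<Sum>x\<in>A. of_nat (count_list (y # xs) x) * f x)
      = (\<Sum>x\<in>A. (if x = y then f x else 0) + of_nat (count_list xs x) * f x)"
    by (rule sum.cong) (auto simp: algebra_simps)
  then show ?case using Cons assms(1) by (simp add: sum.distrib)
qed simp

lemma sum_list_map_bit:
  fixes f :: "'x \<Rightarrow> bit"
  shows "sum_list (map f xs) = (\<Sum>x\<in>{x \<in> set xs. odd (count_list xs x)}. f x)"
proof -
  have "sum_list (map f xs) = (\<Sum>x\<in>set xs. of_nat (count_list xs x) * f x)"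
    by (rule sum_list_map_eq_sum_of_nat_count) auto
  also have "\<dots> = (\<Sum>x\<in>set xs. if odd (count_list xs x) then f x else 0)"
    by (rule sum.cong) (auto simp: of_nat_bit)
  finally show ?thesis
    by (simp only: sum.inter_filter finite_set)
qed

text \<open>Sending \<open>(l, g, v)\<close> to the reduction of \<open>l + g \<otimes> g\<close> modulo 2 is a homomorphism
  on the ambient group, and it maps \<^term>\<open>weyl_gen t\<close> to the tensor square of \<^term>\<open>mod2 t\<close>.\<close>

lemma word_eval_mod2:
  assumes "word_eval w = (l, g, v)"
  shows "of_int (Poly_Mapping.lookup l (i, j))
      + of_int (Poly_Mapping.lookup g i) * of_int (Poly_Mapping.lookup g j)
    = sum_list (map (\<lambda>r. Poly_Mapping.lookup (tensor2 r r) (i, j)) (mod2_word w))"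
  using assms
proof (induction w arbitrary: l g v)
  case Nil
  then show ?case by simp
next
  case (Cons x w)
  obtain l' g' v' where e: "word_eval w = (l', g', v')" by (cases "word_eval w")
  let ?b = "\<lambda>n. of_int n :: bit"
  define a a' b b' k where "a = ?b (Poly_Mapping.lookup (fst x) i)" "a' = ?b (Poly_Mapping.lookup (fst x) j)"
    "b = ?b (Poly_Mapping.lookup g' i)" "b' = ?b (Poly_Mapping.lookup g' j)"
    "k = ?b (Poly_Mapping.lookup l' (i, j))"
  have "l = l' - wedge (fst x) g'" "g = fst x - g'"
    using Cons.prems e by (simp_all add: word_eval_Cons weyl_gen_def del: word_eval.simps)
  then have "?b (Poly_Mapping.lookup l (i, j)) + ?b (Poly_Mapping.lookup g i) * ?b (Poly_Mapping.lookup g j)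
      = k - (a * b' - a' * b) + (a - b) * (a' - b')"
    by (simp add: a_a'_b_b'_k_def lookup_minus lookup_wedge)
  \<comment> \<open>Formal expansion gives the right-hand side minus \<open>2 * a * b'\<close>, and
    2 vanishes in \<open>bit\<close>.\<close>
  also have "\<dots> = a * a' + (k + b * b')"
    by (cases a; cases a'; cases b; cases b'; cases k) simp_all
  finally show ?case
    unfolding mod2_word_simps list.map sum_list.Cons lookup_tensor2 lookup_mod2
    using Cons.IH[OF e] by (simp only: a_a'_b_b'_k_def lookup_tensor2 lookup_mod2)
qed

lemma word_eval_sign: "snd (snd (word_eval w)) = (-1) ^ length w"
proof (induction w)
  case (Cons x w)
  then show ?case
    by (cases "word_eval w") (simp add: word_eval_Cons weyl_gen_def del: word_eval.simps)
qed simp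

lemma ext_square_diagonal: "l \<in> ext_square \<Longrightarrow> Poly_Mapping.lookup l (i, i) = 0"
  by (induction rule: ext_square_induct) (simp_all add: lookup_wedge lookup_add)

section \<open>The kernel\<close>

lemma double_eq_zero: "(h :: 'x \<Rightarrow>\<^sub>0 int) + h = 0 \<Longrightarrow> h = 0"
  by (auto simp: poly_mapping_eq_iff fun_eq_iff lookup_add)

context reflection_space
begin

text \<open>Two letters of the same class modulo 2 can be moved next to each other, because conjugation
  does not change the class of a letter.\<close>

lemma even_counts_normal_form:
  assumes "T_word T w" "\<And>r. even (count_list (mod2_word w) r)"
  shows "\<exists>h m. m \<in> ext_square \<and> cls w = q h \<otimes>\<^bsub>U\<^esub> phi m"
  using assms
proof (induction "length w" arbitrary: w rule: less_induct)
  case less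
  show ?case
  proof (cases w)
    case Nil
    have "q 0 = \<one>\<^bsub>U\<^esub>"
      by (simp add: q_def \<xi>_square zero_mem)
    then show ?thesis
      using Nil by (intro exI[of _ 0]) (simp add: ext_square_zero phi_zero flip: one_U)
  next
    case (Cons x w')
    define t where "t = fst x"
    have "odd (count_list (mod2_word w') (mod2 t))"
      using less.prems(2)[of "mod2 t"] Cons by (simp add: t_def)
    then have "mod2 t \<in> set (mod2_word w')"
      by (metis count_list_0_iff even_zero)
    then obtain y where y: "y \<in> set w'" "mod2 (fst y) = mod2 t"
      by (auto simp: mod2_word_def)
    then obtain a b where w': "w' = a @ y # b" by (meson split_list)
    define s where "s = fst y"
    have T: "t \<in> T" "s \<in> T" "T_word T a" "T_word T b"
      using less.prems(1) Cons w' by (auto simp: t_def s_def)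
    \<comment> \<open>The index that the letter \<open>s\<close> acquires when it is moved to the
      left across \<open>a\<close>.\<close>
    define s' where "s' = tr (cls a) + tr (cls a) + frag_cmul (sg (cls a)) s"
    have s': "s' \<in> T" using T act_mem cls_closed by (simp add: s'_def)
    have [simp]: "cls a \<in> carrier U" "cls b \<in> carrier U" "\<xi> s \<in> carrier U" "\<xi> s' \<in> carrier U" "\<xi> t \<in> carrier U"
      using T s' by (auto intro: cls_closed)
    have "sg (cls a) = 1 \<or> sg (cls a) = -1"
      using U_to_W_split[of "cls a"] by auto
    then have "mod2 s' = mod2 t"
      using y by (auto simp: s'_def mod2_translate mod2_uminus s_def)
    then obtain h where h: "t = h + h + s'" by (metis mod2_eqE)
    have "cls a \<otimes>\<^bsub>U\<^esub> \<xi> s \<otimes>\<^bsub>U\<^esub> inv\<^bsub>U\<^esub> cls a = \<xi> s'"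
      using conj_\<xi>[of "cls a" s] T by (simp add: s'_def)
    then have move: "cls a \<otimes>\<^bsub>U\<^esub> \<xi> s = \<xi> s' \<otimes>\<^bsub>U\<^esub> cls a"
      by (metis U.inv_solve_right' U.m_closed \<open>cls a \<in> carrier U\<close> \<open>\<xi> s \<in> carrier U\<close> \<open>\<xi> s' \<in> carrier U\<close>)
    have "\<exists>h m. m \<in> ext_square \<and> cls (a @ b) = q h \<otimes>\<^bsub>U\<^esub> phi m"
    proof (rule less.hyps)
      show "length (a @ b) < length w" by (simp add: Cons w')
      show "T_word T (a @ b)" using T by simp
      show "even (count_list (mod2_word (a @ b)) r)" for r
        using less.prems(2)[of r] y by (auto simp: Cons w' t_def split: if_splits)
    qed
    then obtain h2 m2 where IH: "m2 \<in> ext_square" "cls (a @ b) = q h2 \<otimes>\<^bsub>U\<^esub> phi m2" by blast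
    have "cls w = \<xi> t \<otimes>\<^bsub>U\<^esub> (cls a \<otimes>\<^bsub>U\<^esub> \<xi> s \<otimes>\<^bsub>U\<^esub> cls b)"
      using less.prems(1) T unfolding Cons w'
      by (simp add: cls_Cons t_def s_def U.m_assoc flip: mult_cls)
    also have "\<dots> = \<xi> t \<otimes>\<^bsub>U\<^esub> \<xi> s' \<otimes>\<^bsub>U\<^esub> cls (a @ b)"
      unfolding move using T by (simp add: U.m_assoc flip: mult_cls)
    also have "\<dots> = q h \<otimes>\<^bsub>U\<^esub> (phi (wedge s' h) \<otimes>\<^bsub>U\<^esub> q h2) \<otimes>\<^bsub>U\<^esub> phi m2"
      unfolding h IH(2) \<xi>_translate_mult_\<xi>[OF s'] by (simp add: U.m_assoc)
    \<comment> \<open>The values of \<open>phi\<close> are central and are collected on the right;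
      the two \<open>q\<close> factors then merge, at the price of another value of
      \<open>phi\<close>.\<close>
    also have "\<dots> = q h \<otimes>\<^bsub>U\<^esub> q h2 \<otimes>\<^bsub>U\<^esub> (phi (wedge s' h) \<otimes>\<^bsub>U\<^esub> phi m2)"
      by (simp add: phi_central[OF q_closed, symmetric] U.m_assoc)
    also have "\<dots> = q (h + h2) \<otimes>\<^bsub>U\<^esub> phi (wedge h h2 + wedge h h2 + (wedge s' h + m2))"
      unfolding q_mult by (simp add: U.m_assoc phi_add)
    finally show ?thesis
      using IH(1) by (intro exI[of _ "h + h2"] exI[of _ "wedge h h2 + wedge h h2 + (wedge s' h + m2)"])
        (simp add: ext_square_add ext_square_wedge)
  qed
qed

lemma cls_eq_one_if_even_counts:
  assumes "T_word T w" "word_eval w = (0, 0, 1)" "\<And>r. even (count_list (mod2_word w) r)"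
  shows "cls w = \<one>\<^bsub>U\<^esub>"
proof -
  obtain h m where hm: "m \<in> ext_square" "cls w = q h \<otimes>\<^bsub>U\<^esub> phi m"
    using even_counts_normal_form assms by blast
  have "U_to_W (cls w) = (m + m, h + h, 1)"
    using hm by (simp add: U_to_W_q U_to_W_phi)
  then have "m + m = 0" "h + h = 0"
    using assms U_to_W_cls by simp_all
  then have "m = 0" "h = 0"
    using double_eq_zero by blast+
  then show ?thesis
    using hm by (simp add: phi_zero q_def \<xi>_square zero_mem)
qed

text \<open>By \<open>word_eval_mod2\<close> the tensor squares of the classes with odd multiplicity
  sum to zero, so independence excludes all nonzero ones. The class 0 has zero tensor square and is
  excluded by the sign instead.\<close>

lemma cls_eq_one_if_two_independent:
  assumes "two_independent (mod2 ` T - {0})" "T_word T w" "word_eval w = (0, 0, 1)"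
  shows "cls w = \<one>\<^bsub>U\<^esub>"
proof (rule cls_eq_one_if_even_counts)
  define Odd where "Odd = {r \<in> set (mod2_word w). odd (count_list (mod2_word w) r)}"
  have "(\<Sum>r\<in>Odd - {0}. tensor2 r r) = 0"
  proof (rule poly_mapping_eqI)
    fix p :: "'b \<times> 'b"
    obtain i j where p: "p = (i, j)" by (cases p)
    have "(\<Sum>r\<in>Odd - {0}. Poly_Mapping.lookup (tensor2 r r) (i, j))
        = (\<Sum>r\<in>Odd. Poly_Mapping.lookup (tensor2 r r) (i, j))"
      by (rule sum.mono_neutral_left) (auto simp: Odd_def lookup_tensor2)
    also have "\<dots> = 0"
      using word_eval_mod2[OF assms(3), of i j] by (simp add: sum_list_map_bit Odd_def)
    finally show "Poly_Mapping.lookup (\<Sum>r\<in>Odd - {0}. tensor2 r r) p = Poly_Mapping.lookup 0 p"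
      by (simp add: lookup_sum p)
  qed
  moreover have "Odd - {0} \<subseteq> mod2 ` T - {0}"
    using assms(2) by (auto simp: Odd_def mod2_word_def T_word_def)
  moreover have "finite (Odd - {0})" by (simp add: Odd_def)
  ultimately have "Odd - {0} = {}"
    using assms(1) unfolding two_independent_def two_dependent_iff by blast
  then consider "Odd = {}" | "Odd = {0}" by blast
  then have "Odd = {}"
  proof cases
    case 2
    \<comment> \<open>Modulo 2 the length equals the number of classes with odd multiplicity, which
      would be 1 if \<open>Odd\<close> were \<open>{0}\<close>.\<close>
    have "even (length w)"
      using word_eval_sign[of w] assms(3) by (cases "even (length w)") simp_all
    then have "sum_list (map (\<lambda>_. 1 :: bit) (mod2_word w)) = 0"
      by (simp add: sum_list_replicate map_replicate_const of_nat_bit mod2_word_def)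
    then show ?thesis using 2 by (simp add: sum_list_map_bit flip: Odd_def)
  qed
  then show "even (count_list (mod2_word w) r)" for r
    by (cases "r \<in> set (mod2_word w)") (auto simp: Odd_def)
qed (use assms in auto)

text \<open>The parity of the number of letters of class \<open>r\<close>; it vanishes on commutators.\<close>

definition par :: "'b G2 \<Rightarrow> 'b word set \<Rightarrow> bit" where
  "par r u = of_nat (count_list (mod2_word (SOME w. w \<in> u)) r)"

lemma par_cls: "T_word T w \<Longrightarrow> par r (cls w) = of_nat (count_list (mod2_word w) r)"
  using even_count_mod2_word_pres_rel[OF some_mem_cls[of w]] by (simp add: par_def of_nat_bit)

lemma par_one: "par r \<one>\<^bsub>U\<^esub> = 0"
  by (simp add: one_U par_cls)

lemma par_mult: "u \<in> carrier U \<Longrightarrow> w \<in> carrier U \<Longrightarrow> par r (u \<otimes>\<^bsub>U\<^esub> w) = par r u + par r w"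
  by (auto simp: carrier_U mult_cls par_cls)

lemma par_inv:
  assumes "u \<in> carrier U"
  shows "par r (inv\<^bsub>U\<^esub> u) = par r u"
  using par_mult[of u "inv\<^bsub>U\<^esub> u" r] assms
  by (cases "par r u"; cases "par r (inv\<^bsub>U\<^esub> u)") (simp_all add: par_one)

lemma par_c: "par r (c g h) = 0"
proof -
  obtain u w where uw: "lifts u g" "lifts w h" using lifts_exists by metis
  then have "c g h = U.comm u w" "u \<in> carrier U" "w \<in> carrier U"
    using comm_eq_c lifts_closed by auto
  then show ?thesis
    by (cases "par r u"; cases "par r w") (simp_all add: U.comm_def par_mult par_inv)
qed

lemma par_phi: "l \<in> ext_square \<Longrightarrow> par r (phi l) = 0"
  by (induction rule: ext_square_induct) (simp_all add: phi_zero par_one phi_wedge par_c phi_add par_mult)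

text \<open>Both letters of \<open>q h\<close> have class 0, so every class occurs either twice or
  not at all.\<close>

lemma par_q: "par r (q h) = 0"
proof -
  have "mod2 (h + h) = 0" using mod2_translate[of h 0] mod2_zero by simp
  then show ?thesis
    using zero_mem double_mem[of h]
    by (simp add: q_def \<xi>_def par_cls mult_cls mod2_zero)
qed

lemma two_independent_if_trivial_kernel:
  assumes inj: "\<And>u. u \<in> carrier U \<Longrightarrow> U_to_W u = (0, 0, 1) \<Longrightarrow> u = \<one>\<^bsub>U\<^esub>"
  shows "two_independent (mod2 ` T - {0})"
proof (rule ccontr)
  assume "\<not> two_independent (mod2 ` T - {0})"
  then obtain F where F: "finite F" "F \<noteq> {}" "F \<subseteq> mod2 ` T - {0}" "(\<Sum>r\<in>F. tensor2 r r) = 0"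
    unfolding two_independent_def two_dependent_iff by blast
  obtain rs where rs: "set rs = F" "distinct rs"
    using finite_distinct_list F(1) by blast
  have "\<forall>r\<in>F. \<exists>t. t \<in> T \<and> mod2 t = r" using F(3) by blast
  then obtain rep where rep: "\<And>r. r \<in> F \<Longrightarrow> rep r \<in> T \<and> mod2 (rep r) = r" by metis
  \<comment> \<open>Padding each representative with the letter 0 makes the length even, hence the
    sign 1. It affects neither the tensor sum nor the multiplicity of a nonzero class.\<close>
  define word where "word = (\<lambda>rs. concat (map (\<lambda>r. [(rep r, True), (0 :: 'b fag, True)]) rs))"
  have word: "T_word T (word xs)" "even (length (word xs))"
      "r \<noteq> 0 \<Longrightarrow> count_list (mod2_word (word xs)) r = count_list xs r"
      "sum_list (map (\<lambda>r. Poly_Mapping.lookup (tensor2 r r) (i, j)) (mod2_word (word xs)))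
        = sum_list (map (\<lambda>r. Poly_Mapping.lookup (tensor2 r r) (i, j)) xs)"
    if "set xs \<subseteq> F" for xs r i j
    using that
    by (induction xs) (auto simp: word_def rep zero_mem mod2_zero lookup_tensor2)
  define w where "w = word rs"
  have w: "T_word T w" using word rs by (simp add: w_def)
  obtain L g v where e: "word_eval w = (L, g, v)" by (cases "word_eval w")
  have v: "v = 1"
    using word_eval_sign[of w] e word(2)[of rs] rs by (simp add: w_def)
  have L: "L \<in> ext_square"
    using word_eval_closed[of w] e by (simp add: carrier_amb_group)
  have zero: "(of_int (Poly_Mapping.lookup L (i, j)) :: bit)
      + of_int (Poly_Mapping.lookup g i) * of_int (Poly_Mapping.lookup g j) = 0" for i j
  proof -
    have "sum_list (map (\<lambda>r. Poly_Mapping.lookup (tensor2 r r) (i, j)) rs)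
        = Poly_Mapping.lookup (\<Sum>r\<in>F. tensor2 r r) (i, j)"
      using rs by (simp add: lookup_sum sum_list_distinct_conv_sum_set)
    then show ?thesis
      using word_eval_mod2[OF e, of i j] word(4)[of rs i j] rs F(4) by (simp add: w_def)
  qed
  \<comment> \<open>The diagonal of \<open>L\<close> vanishes, so the diagonal of
    \<open>zero\<close> forces the entries of \<open>g\<close> to be even; the quadratic term then
    drops out and \<open>L\<close> is even as well.\<close>
  have g: "even (Poly_Mapping.lookup g i)" for i
    using zero[of i i] ext_square_diagonal[OF L, of i] by (auto simp: of_int_bit split: if_splits)
  have "even (Poly_Mapping.lookup L p)" for p
    using zero[of "fst p" "snd p"] g by (auto simp: of_int_bit split: if_splits)
  then obtain m where m: "L = m + m" using halve_exists by blast
  \<comment> \<open>Membership of the half \<open>m\<close> is essential: \<open>U_to_W_phi\<close>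
    and \<open>par_phi\<close> speak only of the exterior square.\<close>
  then have m': "m \<in> ext_square" using ext_square_halve L by blast
  obtain h where h: "g = h + h" using halve_exists g by blast
  \<comment> \<open>The image of \<open>w\<close> is \<open>(m + m, h + h, 1)\<close>; the two
    correction factors cancel it and have parity 0 for every class.\<close>
  define u where "u = cls w \<otimes>\<^bsub>U\<^esub> q (- h) \<otimes>\<^bsub>U\<^esub> phi (- m)"
  have u: "u \<in> carrier U" using cls_closed[OF w] by (simp add: u_def)
  have "U_to_W u = (0, 0, 1)"
    using cls_closed[OF w] m'
    by (simp add: u_def U_to_W_cls w e v m h U_to_W_q U_to_W_phi ext_square_uminus wedge_add_left wedge_add_right)
  then have "u = \<one>\<^bsub>U\<^esub>" using inj u by blast
  then have "par r u = 0" for r by (simp add: par_one)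
  moreover obtain r where r: "r \<in> F" using F(2) by blast
  \<comment> \<open>A class of the dependency is listed once in \<open>rs\<close> and is not 0, so
    it occurs exactly once in \<open>w\<close>, which contradicts triviality of
    \<open>u\<close>.\<close>
  moreover have "count_list rs r = 1"
    using r rs by (simp add: count_list_distinct)
  then have "count_list (mod2_word w) r = 1"
    using word(3)[of rs r] rs r F(3) by (auto simp: w_def)
  then have "par r u = 1"
    using cls_closed[OF w] m' by (simp add: u_def par_mult par_cls[OF w] par_q par_phi ext_square_uminus)
  ultimately show False by simp
qed

section \<open>The image of the homomorphism and the reduction to its kernel\<close>

lemma U_to_W_image: "U_to_W ` carrier U = generate amb_group (weyl_gen ` T)"
proof
  have "word_eval w \<in> generate amb_group (weyl_gen ` T)" if "T_word T w" for w
    using that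
  proof (induction w)
    case Nil
    then show ?case using generate.one[of amb_group] by simp
  next
    case (Cons x w)
    then show ?case
      unfolding word_eval_Cons by (intro generate.eng generate.incl[of "weyl_gen (fst x)"]) auto
  qed
  then show "U_to_W ` carrier U \<subseteq> generate amb_group (weyl_gen ` T)"
    by (auto simp: carrier_U U_to_W_cls)
next
  show "generate amb_group (weyl_gen ` T) \<subseteq> U_to_W ` carrier U"
  proof (rule amb.generate_subgroup_incl)
    show "subgroup (U_to_W ` carrier U) amb_group"
      by (rule group_hom.img_is_subgroup[OF group_hom_U_to_W])
    show "weyl_gen ` T \<subseteq> U_to_W ` carrier U"
    proof
      fix y assume "y \<in> weyl_gen ` T"
      then obtain t where "t \<in> T" "y = U_to_W (\<xi> t)" by (auto simp: U_to_W_\<xi> weyl_gen_def)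
      then show "y \<in> U_to_W ` carrier U" by simp
    qed
  qed
qed

text \<open>Surjectivity onto the Weyl group is automatic by \<open>U_to_W_image\<close>, so only
  injectivity is at stake.\<close>

lemma U_to_W_iso_iff:
  "U_to_W \<in> iso U (weyl_group T) \<longleftrightarrow> (\<forall>u \<in> carrier U. U_to_W u = (0, 0, 1) \<longrightarrow> u = \<one>\<^bsub>U\<^esub>)"
proof -
  have "U_to_W \<in> hom U (weyl_group T)"
    using U_to_W_image by (auto simp: hom_def weyl_group_def)
  then have "U_to_W \<in> iso U (weyl_group T) \<longleftrightarrow> inj_on U_to_W (carrier U)"
    using U_to_W_image by (auto simp: iso_def bij_betw_def weyl_group_def)
  then show ?thesis
    using group_hom.inj_on_one_iff[OF group_hom_U_to_W] by auto
qed

end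

theorem theorem5p1:
  fixes T :: "('b \<Rightarrow>\<^sub>0 int) set"
  assumes "generate fag_group T = UNIV"
    and "0 \<in> T"
    and "\<And>g t. t \<in> T \<Longrightarrow> g + g - t \<in> T"
  shows "U_to_W \<in> iso (U_group T) (weyl_group T) \<longleftrightarrow>
         two_independent (mod2 ` T - {0})"
proof -
  interpret reflection_space T
    using assms by unfold_locales
  show ?thesis
    unfolding U_to_W_iso_iff
  proof
    assume "\<forall>u \<in> carrier U. U_to_W u = (0, 0, 1) \<longrightarrow> u = \<one>\<^bsub>U\<^esub>"
    then show "two_independent (mod2 ` T - {0})"
      using two_independent_if_trivial_kernel by blast
  next
    assume "two_independent (mod2 ` T - {0})"
    then show "\<forall>u \<in> carrier U. U_to_W u = (0, 0, 1) \<longrightarrow> u = \<one>\<^bsub>U\<^esub>"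
      using cls_eq_one_if_two_independent by (auto simp: carrier_U U_to_W_cls)
  qed
qed

end
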